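(* For every $\Sigma$-sentence $\phi$ of $\mathcal{L}_{BT}$: if $\mathfrak{F}\models\phi$, then $F'\vdash\phi$.
   Context: Bit strings are elements of $\{\mathbf{0},\mathbf{1}\}^*$; $\varepsilon$ is the empty string, $|\alpha|$ the length. The language $\mathcal{L}_{BT}$ has constant symbols $e,0,1$, binary function symbol $\circ$ (also written as juxtaposition), and binary relation symbol $\sqsubseteq$. The structure $\mathfrak{F}$ has universe $\{\mathbf{0},\mathbf{1}\}^*$, interprets $e,0,1$ as $\varepsilon,\mathbf{0},\mathbf{1}$, $\circ$ as concatenation, and $\alpha\sqsubseteq\beta$ as $|\alpha|\le|\beta|$. $(\exists x\sqsubseteq t)\phi$ abbreviates $\exists x[x\sqsubseteq t\wedge\phi]$, $(\forall x\sqsubseteq t)\phi$ abbreviates $\forall x[x\sqsubseteq t\to\phi]$. $\Sigma$-formulas: $s\sqsubseteq t$, $\neg s\sqsubseteq t$, $s=t$, $\neg s=t$ (terms $s,t$) are $\Sigma$-formulas; they are closed under $\wedge,\vee$, and under $(\exists x\sqsubseteq t)$, $(\forall x\sqsubseteq t)$ and $\exists x$ where $x$ does not occur in $t$. Biterals: $\overline{\varepsilon}=e$, $\overline{\alpha\mathbf{0}}=\overline{\alpha}\circ 0$, $\overline{\alpha\mathbf{1}}=\overline{\alpha}\circ 1$. For $\alpha\in\{\mathbf{0},\mathbf{1}\}^*$ let $[\varepsilon\ldots\alpha]=\{\beta\in\{\mathbf{0},\mathbf{1}\}^*:|\beta|\le|\alpha|\}$. The theory $F'$ has the axioms: (1)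 $\forall x[x=ex\wedge x=xe]$; (2) $\forall xyz[(xy)z=x(yz)]$; (3) $\forall xy[x\neq y\to(x0\neq y0\wedge x1\neq y1)]$; (4) $\forall xy[x0\neq y1]$; (5) $\forall x[e\sqsubseteq x]$; (6) $\forall x[x\sqsubseteq e\to x=e]$; (7)–(10): for each $a,b\in\{0,1\}$, $\forall xy[xa\sqsubseteq yb\leftrightarrow x\sqsubseteq y]$; and, for every $\alpha\in\{\mathbf{0},\mathbf{1}\}^*$, the axiom $\forall x[x\sqsubseteq\overline{\alpha}\to\bigvee_{\beta\in[\varepsilon\ldots\alpha]}x=\overline{\beta}]$. *)

theory Defs
  imports Main
begin

section \<open>Syntax\<close>

datatype tm =
    Var nat
  | Eps  (\<open>\<^bold>e\<close>)
  | Zero (\<open>\<^bold>0\<close>)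
  | One  (\<open>\<^bold>1\<close>)
  | Conc tm tm (infixl \<open>\<^bold>\<circ>\<close> 85)

datatype fm =
    Eq tm tm (infix \<open>\<^bold>=\<close> 80)
  | Le tm tm (infix \<open>\<^bold>\<sqsubseteq>\<close> 80)
  | Neg fm (\<open>\<^bold>\<not> _\<close> [70] 70)
  | Con fm fm (infixr \<open>\<^bold>\<and>\<close> 60)
  | Dis fm fm (infixr \<open>\<^bold>\<or>\<close> 55)
  | Imp fm fm (infixr \<open>\<^bold>\<longrightarrow>\<close> 50)
  | Forall nat fm (\<open>\<^bold>\<forall>_. _\<close> [1000, 45] 45)
  | Exists nat fm (\<open>\<^bold>\<exists>_. _\<close> [1000, 45] 45)

abbreviation Iff :: "fm \<Rightarrow> fm \<Rightarrow> fm" (infix \<open>\<^bold>\<longleftrightarrow>\<close> 48) where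
  "\<phi> \<^bold>\<longleftrightarrow> \<psi> \<equiv> (\<phi> \<^bold>\<longrightarrow> \<psi>) \<^bold>\<and> (\<psi> \<^bold>\<longrightarrow> \<phi>)"

abbreviation BExists :: "nat \<Rightarrow> tm \<Rightarrow> fm \<Rightarrow> fm" where
  "BExists x t \<phi> \<equiv> \<^bold>\<exists>x. (Var x \<^bold>\<sqsubseteq> t \<^bold>\<and> \<phi>)"

abbreviation BForall :: "nat \<Rightarrow> tm \<Rightarrow> fm \<Rightarrow> fm" where
  "BForall x t \<phi> \<equiv> \<^bold>\<forall>x. (Var x \<^bold>\<sqsubseteq> t \<^bold>\<longrightarrow> \<phi>)"

primrec vars_tm :: "tm \<Rightarrow> nat set" where
  "vars_tm (Var x) = {x}"
| "vars_tm \<^bold>e = {}"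
| "vars_tm \<^bold>0 = {}"
| "vars_tm \<^bold>1 = {}"
| "vars_tm (s \<^bold>\<circ> t) = vars_tm s \<union> vars_tm t"

primrec fv :: "fm \<Rightarrow> nat set" where
  "fv (s \<^bold>= t) = vars_tm s \<union> vars_tm t"
| "fv (s \<^bold>\<sqsubseteq> t) = vars_tm s \<union> vars_tm t"
| "fv (\<^bold>\<not> \<phi>) = fv \<phi>"
| "fv (\<phi> \<^bold>\<and> \<psi>) = fv \<phi> \<union> fv \<psi>"
| "fv (\<phi> \<^bold>\<or> \<psi>) = fv \<phi> \<union> fv \<psi>"
| "fv (\<phi> \<^bold>\<longrightarrow> \<psi>) = fv \<phi> \<union> fv \<psi>"
| "fv (\<^bold>\<forall>x. \<phi>) = fv \<phi> - {x}"
| "fv (\<^bold>\<exists>x. \<phi>) = fv \<phi> - {x}"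

definition sentence :: "fm \<Rightarrow> bool" where
  "sentence \<phi> \<longleftrightarrow> fv \<phi> = {}"

inductive Sigma_formula :: "fm \<Rightarrow> bool" where
  "Sigma_formula (s \<^bold>\<sqsubseteq> t)"
| "Sigma_formula (\<^bold>\<not> s \<^bold>\<sqsubseteq> t)"
| "Sigma_formula (s \<^bold>= t)"
| "Sigma_formula (\<^bold>\<not> s \<^bold>= t)"
| "Sigma_formula \<phi> \<Longrightarrow> Sigma_formula \<psi> \<Longrightarrow> Sigma_formula (\<phi> \<^bold>\<and> \<psi>)"
| "Sigma_formula \<phi> \<Longrightarrow> Sigma_formula \<psi> \<Longrightarrow> Sigma_formula (\<phi> \<^bold>\<or> \<psi>)"
| "Sigma_formula \<phi> \<Longrightarrow> x \<notin> vars_tm t \<Longrightarrow> Sigma_formula (BExists x t \<phi>)"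
| "Sigma_formula \<phi> \<Longrightarrow> x \<notin> vars_tm t \<Longrightarrow> Sigma_formula (BForall x t \<phi>)"
| "Sigma_formula \<phi> \<Longrightarrow> Sigma_formula (\<^bold>\<exists>x. \<phi>)"


section \<open>The structure of bit strings\<close>

text \<open>The bit \<open>0\<close> is \<^const>\<open>False\<close> and the bit \<open>1\<close> is \<^const>\<open>True\<close>.\<close>

type_synonym bitstring = "bool list"

primrec eval :: "(nat \<Rightarrow> bitstring) \<Rightarrow> tm \<Rightarrow> bitstring" where
  "eval v (Var x) = v x"
| "eval v \<^bold>e = []"
| "eval v \<^bold>0 = [False]"
| "eval v \<^bold>1 = [True]"
| "eval v (s \<^bold>\<circ> t) = eval v s @ eval v t"

primrec sat :: "(nat \<Rightarrow> bitstring) \<Rightarrow> fm \<Rightarrow> bool" where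
  "sat v (s \<^bold>= t) \<longleftrightarrow> eval v s = eval v t"
| "sat v (s \<^bold>\<sqsubseteq> t) \<longleftrightarrow> length (eval v s) \<le> length (eval v t)"
| "sat v (\<^bold>\<not> \<phi>) \<longleftrightarrow> \<not> sat v \<phi>"
| "sat v (\<phi> \<^bold>\<and> \<psi>) \<longleftrightarrow> sat v \<phi> \<and> sat v \<psi>"
| "sat v (\<phi> \<^bold>\<or> \<psi>) \<longleftrightarrow> sat v \<phi> \<or> sat v \<psi>"
| "sat v (\<phi> \<^bold>\<longrightarrow> \<psi>) \<longleftrightarrow> (sat v \<phi> \<longrightarrow> sat v \<psi>)"
| "sat v (\<^bold>\<forall>x. \<phi>) \<longleftrightarrow> (\<forall>\<alpha>. sat (v(x := \<alpha>)) \<phi>)"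
| "sat v (\<^bold>\<exists>x. \<phi>) \<longleftrightarrow> (\<exists>\<alpha>. sat (v(x := \<alpha>)) \<phi>)"

definition true_in_F :: "fm \<Rightarrow> bool" (\<open>\<FF> \<Turnstile> _\<close> [40] 40) where
  "\<FF> \<Turnstile> \<phi> \<longleftrightarrow> (\<forall>v. sat v \<phi>)"


section \<open>First-order provability\<close>

primrec subst_tm :: "nat \<Rightarrow> tm \<Rightarrow> tm \<Rightarrow> tm" where
  "subst_tm x t (Var y) = (if y = x then t else Var y)"
| "subst_tm x t \<^bold>e = \<^bold>e"
| "subst_tm x t \<^bold>0 = \<^bold>0"
| "subst_tm x t \<^bold>1 = \<^bold>1"
| "subst_tm x t (r \<^bold>\<circ> s) = subst_tm x t r \<^bold>\<circ> subst_tm x t s"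

text \<open>Replacement of the free occurrences of \<open>x\<close>, without renaming of bound variables. It is used
  only under the proviso \<open>free_for x t \<phi>\<close> below, which excludes capture.\<close>

primrec subst :: "nat \<Rightarrow> tm \<Rightarrow> fm \<Rightarrow> fm" where
  "subst x t (r \<^bold>= s) = (subst_tm x t r \<^bold>= subst_tm x t s)"
| "subst x t (r \<^bold>\<sqsubseteq> s) = (subst_tm x t r \<^bold>\<sqsubseteq> subst_tm x t s)"
| "subst x t (\<^bold>\<not> \<phi>) = (\<^bold>\<not> subst x t \<phi>)"
| "subst x t (\<phi> \<^bold>\<and> \<psi>) = (subst x t \<phi> \<^bold>\<and> subst x t \<psi>)"
| "subst x t (\<phi> \<^bold>\<or> \<psi>) = (subst x t \<phi> \<^bold>\<or> subst x t \<psi>)"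
| "subst x t (\<phi> \<^bold>\<longrightarrow> \<psi>) = (subst x t \<phi> \<^bold>\<longrightarrow> subst x t \<psi>)"
| "subst x t (\<^bold>\<forall>y. \<phi>) = (\<^bold>\<forall>y. (if y = x then \<phi> else subst x t \<phi>))"
| "subst x t (\<^bold>\<exists>y. \<phi>) = (\<^bold>\<exists>y. (if y = x then \<phi> else subst x t \<phi>))"

primrec free_for :: "nat \<Rightarrow> tm \<Rightarrow> fm \<Rightarrow> bool" where
  "free_for x t (r \<^bold>= s) \<longleftrightarrow> True"
| "free_for x t (r \<^bold>\<sqsubseteq> s) \<longleftrightarrow> True"
| "free_for x t (\<^bold>\<not> \<phi>) \<longleftrightarrow> free_for x t \<phi>"
| "free_for x t (\<phi> \<^bold>\<and> \<psi>) \<longleftrightarrow> free_for x t \<phi> \<and> free_for x t \<psi>"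
| "free_for x t (\<phi> \<^bold>\<or> \<psi>) \<longleftrightarrow> free_for x t \<phi> \<and> free_for x t \<psi>"
| "free_for x t (\<phi> \<^bold>\<longrightarrow> \<psi>) \<longleftrightarrow> free_for x t \<phi> \<and> free_for x t \<psi>"
| "free_for x t (\<^bold>\<forall>y. \<phi>) \<longleftrightarrow> x \<notin> fv (\<^bold>\<forall>y. \<phi>) \<or> (y \<notin> vars_tm t \<and> free_for x t \<phi>)"
| "free_for x t (\<^bold>\<exists>y. \<phi>) \<longleftrightarrow> x \<notin> fv (\<^bold>\<exists>y. \<phi>) \<or> (y \<notin> vars_tm t \<and> free_for x t \<phi>)"

text \<open>Classical natural deduction with equality. The left-hand side may be infinite; because of
  \<open>Weaken\<close>, the eigenvariable conditions of \<open>ForallI\<close> and \<open>ExistsE\<close> only concern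
  the hypotheses that are actually used.\<close>

inductive provable :: "fm set \<Rightarrow> fm \<Rightarrow> bool" (infix \<open>\<turnstile>\<close> 40) where
  Assm: "\<phi> \<in> \<Gamma> \<Longrightarrow> \<Gamma> \<turnstile> \<phi>"
| Weaken: "\<Gamma> \<turnstile> \<phi> \<Longrightarrow> \<Gamma> \<subseteq> \<Delta> \<Longrightarrow> \<Delta> \<turnstile> \<phi>"
| NegI: "insert \<phi> \<Gamma> \<turnstile> \<psi> \<Longrightarrow> insert \<phi> \<Gamma> \<turnstile> \<^bold>\<not> \<psi> \<Longrightarrow> \<Gamma> \<turnstile> \<^bold>\<not> \<phi>"
| NegNegE: "\<Gamma> \<turnstile> \<^bold>\<not> \<^bold>\<not> \<phi> \<Longrightarrow> \<Gamma> \<turnstile> \<phi>"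
| ConI: "\<Gamma> \<turnstile> \<phi> \<Longrightarrow> \<Gamma> \<turnstile> \<psi> \<Longrightarrow> \<Gamma> \<turnstile> \<phi> \<^bold>\<and> \<psi>"
| ConE1: "\<Gamma> \<turnstile> \<phi> \<^bold>\<and> \<psi> \<Longrightarrow> \<Gamma> \<turnstile> \<phi>"
| ConE2: "\<Gamma> \<turnstile> \<phi> \<^bold>\<and> \<psi> \<Longrightarrow> \<Gamma> \<turnstile> \<psi>"
| DisI1: "\<Gamma> \<turnstile> \<phi> \<Longrightarrow> \<Gamma> \<turnstile> \<phi> \<^bold>\<or> \<psi>"
| DisI2: "\<Gamma> \<turnstile> \<psi> \<Longrightarrow> \<Gamma> \<turnstile> \<phi> \<^bold>\<or> \<psi>"
| DisE: "\<Gamma> \<turnstile> \<phi> \<^bold>\<or> \<psi> \<Longrightarrow> insert \<phi> \<Gamma> \<turnstile> \<chi> \<Longrightarrow> insert \<psi> \<Gamma> \<turnstile> \<chi> \<Longrightarrow> \<Gamma> \<turnstile> \<chi>"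
| ImpI: "insert \<phi> \<Gamma> \<turnstile> \<psi> \<Longrightarrow> \<Gamma> \<turnstile> \<phi> \<^bold>\<longrightarrow> \<psi>"
| ImpE: "\<Gamma> \<turnstile> \<phi> \<^bold>\<longrightarrow> \<psi> \<Longrightarrow> \<Gamma> \<turnstile> \<phi> \<Longrightarrow> \<Gamma> \<turnstile> \<psi>"
| ForallI: "\<Gamma> \<turnstile> \<phi> \<Longrightarrow> \<forall>\<psi>\<in>\<Gamma>. x \<notin> fv \<psi> \<Longrightarrow> \<Gamma> \<turnstile> \<^bold>\<forall>x. \<phi>"
| ForallE: "\<Gamma> \<turnstile> \<^bold>\<forall>x. \<phi> \<Longrightarrow> free_for x t \<phi> \<Longrightarrow> \<Gamma> \<turnstile> subst x t \<phi>"
| ExistsI: "\<Gamma> \<turnstile> subst x t \<phi> \<Longrightarrow> free_for x t \<phi> \<Longrightarrow> \<Gamma> \<turnstile> \<^bold>\<exists>x. \<phi>"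
| ExistsE: "\<Gamma> \<turnstile> \<^bold>\<exists>x. \<phi> \<Longrightarrow> insert \<phi> \<Gamma> \<turnstile> \<chi> \<Longrightarrow> \<forall>\<psi>\<in>\<Gamma>. x \<notin> fv \<psi> \<Longrightarrow> x \<notin> fv \<chi> \<Longrightarrow> \<Gamma> \<turnstile> \<chi>"
| EqRefl: "\<Gamma> \<turnstile> t \<^bold>= t"
| EqSubst: "\<Gamma> \<turnstile> s \<^bold>= t \<Longrightarrow> \<Gamma> \<turnstile> subst x s \<phi> \<Longrightarrow> free_for x s \<phi> \<Longrightarrow> free_for x t \<phi> \<Longrightarrow> \<Gamma> \<turnstile> subst x t \<phi>"


section \<open>The theory \<open>F'\<close>\<close>

definition bit :: "bool \<Rightarrow> tm" where
  "bit b = (if b then \<^bold>1 else \<^bold>0)"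

definition biteral :: "bitstring \<Rightarrow> tm" where
  "biteral \<alpha> = foldl (\<lambda>t b. t \<^bold>\<circ> bit b) \<^bold>e \<alpha>"

lemma biteral_Nil: "biteral [] = \<^bold>e"
  by (simp add: biteral_def)

lemma biteral_snoc_0: "biteral (\<alpha> @ [False]) = biteral \<alpha> \<^bold>\<circ> \<^bold>0"
  by (simp add: biteral_def bit_def)

lemma biteral_snoc_1: "biteral (\<alpha> @ [True]) = biteral \<alpha> \<^bold>\<circ> \<^bold>1"
  by (simp add: biteral_def bit_def)

text \<open>An enumeration by increasing length of the bit strings of length at most \<open>|\<alpha>|\<close>.\<close>

definition up_to :: "bitstring \<Rightarrow> bitstring list" where
  "up_to \<alpha> = concat (map (\<lambda>n. List.n_lists n [False, True]) [0..<Suc (length \<alpha>)])"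

lemma set_up_to: "set (up_to \<alpha>) = {\<beta>. length \<beta> \<le> length \<alpha>}"
  by (auto simp: up_to_def set_n_lists simp del: upt_Suc)

text \<open>The value on the empty list is irrelevant, since \<open>up_to \<alpha>\<close> is never empty.\<close>

fun disjunction :: "fm list \<Rightarrow> fm" where
  "disjunction [] = (\<^bold>\<not> \<^bold>e \<^bold>= \<^bold>e)"
| "disjunction [\<phi>] = \<phi>"
| "disjunction (\<phi> # \<psi> # \<phi>s) = \<phi> \<^bold>\<or> disjunction (\<psi> # \<phi>s)"

inductive_set F' :: "fm set" where
  F1: "(\<^bold>\<forall>0. Var 0 \<^bold>= \<^bold>e \<^bold>\<circ> Var 0 \<^bold>\<and> Var 0 \<^bold>= Var 0 \<^bold>\<circ> \<^bold>e) \<in> F'"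
| F2: "(\<^bold>\<forall>0. \<^bold>\<forall>1. \<^bold>\<forall>2. (Var 0 \<^bold>\<circ> Var 1) \<^bold>\<circ> Var 2 \<^bold>= Var 0 \<^bold>\<circ> (Var 1 \<^bold>\<circ> Var 2)) \<in> F'"
| F3: "(\<^bold>\<forall>0. \<^bold>\<forall>1. \<^bold>\<not> Var 0 \<^bold>= Var 1 \<^bold>\<longrightarrow>
        \<^bold>\<not> Var 0 \<^bold>\<circ> \<^bold>0 \<^bold>= Var 1 \<^bold>\<circ> \<^bold>0 \<^bold>\<and> \<^bold>\<not> Var 0 \<^bold>\<circ> \<^bold>1 \<^bold>= Var 1 \<^bold>\<circ> \<^bold>1) \<in> F'"
| F4: "(\<^bold>\<forall>0. \<^bold>\<forall>1. \<^bold>\<not> Var 0 \<^bold>\<circ> \<^bold>0 \<^bold>= Var 1 \<^bold>\<circ> \<^bold>1) \<in> F'"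
| F5: "(\<^bold>\<forall>0. \<^bold>e \<^bold>\<sqsubseteq> Var 0) \<in> F'"
| F6: "(\<^bold>\<forall>0. Var 0 \<^bold>\<sqsubseteq> \<^bold>e \<^bold>\<longrightarrow> Var 0 \<^bold>= \<^bold>e) \<in> F'"
| F7_10: "a \<in> {\<^bold>0, \<^bold>1} \<Longrightarrow> b \<in> {\<^bold>0, \<^bold>1} \<Longrightarrow>
    (\<^bold>\<forall>0. \<^bold>\<forall>1. Var 0 \<^bold>\<circ> a \<^bold>\<sqsubseteq> Var 1 \<^bold>\<circ> b \<^bold>\<longleftrightarrow> Var 0 \<^bold>\<sqsubseteq> Var 1) \<in> F'"
| F_bound: "(\<^bold>\<forall>0. Var 0 \<^bold>\<sqsubseteq> biteral \<alpha> \<^bold>\<longrightarrow>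
    disjunction (map (\<lambda>\<beta>. Var 0 \<^bold>= biteral \<beta>) (up_to \<alpha>))) \<in> F'"

end

theory Submission
  imports Defs
begin

text \<open>A formula true under a valuation \<open>v\<close> is derived from \<open>F'\<close> together with the hypotheses
  \<open>y = \<beta>\<close>, where \<open>\<beta>\<close> is the biteral of \<open>v y\<close> and \<open>y\<close> ranges over the free variables. With these
  hypotheses in place of a simultaneous substitution of biterals, a quantifier over \<open>x\<close> only
  discharges the hypothesis on \<open>x\<close>: for \<open>\<exists>x\<close> because \<open>\<exists>x. x = \<beta>\<close> is provable, and for a bounded
  \<open>\<forall>x\<close> by splitting the finite disjunction of the last axiom scheme. Atoms reduce to biterals,
  and the key negative fact there is that \<open>xa = e\<close> is refutable: if \<open>b\<close> is the other bit, it gives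
  \<open>eb = b = b(xa) = (bx)a\<close>, against axiom (4).\<close>

section \<open>Substitution and derived rules\<close>

lemma finite_vars_tm [simp]: "finite (vars_tm t)"
  by (induction t) auto

lemma subst_tm_fresh [simp]: "x \<notin> vars_tm t \<Longrightarrow> subst_tm x s t = t"
  by (induction t) auto

lemma subst_tm_Var_self [simp]: "subst_tm x (Var x) t = t"
  by (induction t) auto

lemma subst_Var_self [simp]: "subst x (Var x) \<phi> = \<phi>"
  by (induction \<phi>) auto

lemma free_for_Var_self [simp]: "free_for x (Var x) \<phi>"
  by (induction \<phi>) auto

lemma free_for_closed [simp]: "vars_tm t = {} \<Longrightarrow> free_for x t \<phi>"
  by (induction \<phi>) auto

lemma provable_insert: "\<Gamma> \<turnstile> \<phi> \<Longrightarrow> insert \<psi> \<Gamma> \<turnstile> \<phi>"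
  by (rule Weaken) auto

lemma contradiction: "\<Gamma> \<turnstile> \<phi> \<Longrightarrow> \<Gamma> \<turnstile> \<^bold>\<not> \<phi> \<Longrightarrow> \<Gamma> \<turnstile> \<psi>"
  by (rule NegNegE, rule NegI[of _ _ \<phi>]) (simp_all add: provable_insert)

lemma modus_tollens: "\<Gamma> \<turnstile> \<phi> \<^bold>\<longrightarrow> \<psi> \<Longrightarrow> \<Gamma> \<turnstile> \<^bold>\<not> \<psi> \<Longrightarrow> \<Gamma> \<turnstile> \<^bold>\<not> \<phi>"
  by (rule NegI[of _ _ \<psi>]) (simp_all add: ImpE[of _ \<phi>] provable_insert Assm)

lemma cut: "\<Gamma> \<turnstile> \<phi> \<Longrightarrow> insert \<phi> \<Gamma> \<turnstile> \<psi> \<Longrightarrow> \<Gamma> \<turnstile> \<psi>"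
  by (rule ImpE[OF ImpI])

lemma disjunction_elim:
  assumes "\<Gamma> \<turnstile> disjunction \<phi>s" and "\<And>\<phi>. \<phi> \<in> set \<phi>s \<Longrightarrow> insert \<phi> \<Gamma> \<turnstile> \<chi>"
  shows "\<Gamma> \<turnstile> \<chi>"
  using assms
proof (induction \<phi>s arbitrary: \<Gamma> rule: disjunction.induct)
  case 1
  \<comment> \<open>The empty disjunction is the negation of \<open>e = e\<close>, refuted by
    reflexivity, so anything follows.\<close>
  then show ?case using contradiction[OF EqRefl] by simp
next
  case (2 \<phi>)
  then show ?case using cut[of \<Gamma> \<phi>] by simp
next
  case (3 \<phi> \<psi> \<phi>s)
  let ?\<delta> = "disjunction (\<psi> # \<phi>s)"
  have "insert ?\<delta> \<Gamma> \<turnstile> \<chi>"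
  proof (rule "3.IH")
    show "insert ?\<delta> \<Gamma> \<turnstile> ?\<delta>" by (simp add: Assm)
    show "insert \<theta> (insert ?\<delta> \<Gamma>) \<turnstile> \<chi>" if "\<theta> \<in> set (\<psi> # \<phi>s)" for \<theta>
      using that by (intro Weaken[OF "3.prems"(2)[of \<theta>]]) auto
  qed
  moreover have "insert \<phi> \<Gamma> \<turnstile> \<chi>" using "3.prems"(2) by simp
  ultimately show ?case using "3.prems"(1) by (simp add: DisE[of _ \<phi> ?\<delta>])
qed

text \<open>Since \<open>t\<close> witnesses that some \<open>x\<close> equals it, an equation for a
  fresh \<open>x\<close> may be assumed at no cost. This discharges the hypothesis on a bound
  variable.\<close>

lemma exists_elim_eq:
  assumes "insert (Var x \<^bold>= t) \<Gamma> \<turnstile> \<chi>" and "vars_tm t = {}"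
    and "\<forall>\<psi>\<in>\<Gamma>. x \<notin> fv \<psi>" and "x \<notin> fv \<chi>"
  shows "\<Gamma> \<turnstile> \<chi>"
proof (rule ExistsE)
  show "\<Gamma> \<turnstile> \<^bold>\<exists>x. Var x \<^bold>= t"
    by (rule ExistsI[of _ _ t]) (use assms(2) in \<open>auto intro: EqRefl\<close>)
qed (use assms in auto)

section \<open>Equality\<close>

text \<open>The formula \<open>R a b\<close> may contain further terms, whose variables are collected in \<open>X\<close>.\<close>

lemma replace_equals:
  assumes "finite X"
    and subst: "\<And>x u a b. x \<notin> X \<Longrightarrow> subst x u (R a b) = R (subst_tm x u a) (subst_tm x u b)"
    and free: "\<And>x u a b. free_for x u (R a b)"
    and s: "\<Gamma> \<turnstile> s \<^bold>= s'" and t: "\<Gamma> \<turnstile> t \<^bold>= t'" and "\<Gamma> \<turnstile> R s t"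
  shows "\<Gamma> \<turnstile> R s' t'"
proof -
  \<comment> \<open>The placeholder \<open>x\<close> avoids \<open>t\<close> and \<open>s'\<close>,
    the terms standing beside it when the two arguments are replaced one after the other.\<close>
  obtain x where x: "x \<notin> X \<union> vars_tm s' \<union> vars_tm t"
    using ex_new_if_finite[of "X \<union> vars_tm s' \<union> vars_tm t"] \<open>finite X\<close> by auto
  have "\<Gamma> \<turnstile> R s' t"
    using EqSubst[OF s, of x "R (Var x) t"] x subst free \<open>\<Gamma> \<turnstile> R s t\<close> by simp
  then show ?thesis
    using EqSubst[OF t, of x "R s' (Var x)"] x subst free by simp
qed

lemma eq_sym: "\<Gamma> \<turnstile> s \<^bold>= t \<Longrightarrow> \<Gamma> \<turnstile> t \<^bold>= s"
  using replace_equals[of "{}" "(\<^bold>=)" \<Gamma> s t s s] by (simp add: EqRefl)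

lemma eq_trans: "\<Gamma> \<turnstile> r \<^bold>= s \<Longrightarrow> \<Gamma> \<turnstile> s \<^bold>= t \<Longrightarrow> \<Gamma> \<turnstile> r \<^bold>= t"
  using replace_equals[of "{}" "(\<^bold>=)" \<Gamma> r r s t] by (simp add: EqRefl)

lemma neq_sym: "\<Gamma> \<turnstile> \<^bold>\<not> s \<^bold>= t \<Longrightarrow> \<Gamma> \<turnstile> \<^bold>\<not> t \<^bold>= s"
  by (rule NegI[of _ _ "s \<^bold>= t"]) (simp_all add: eq_sym[of _ t] Assm provable_insert)

lemma conc_cong: "\<Gamma> \<turnstile> s \<^bold>= s' \<Longrightarrow> \<Gamma> \<turnstile> t \<^bold>= t' \<Longrightarrow> \<Gamma> \<turnstile> s \<^bold>\<circ> t \<^bold>= s' \<^bold>\<circ> t'"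
  \<comment> \<open>Only the right copy in the reflexivity instance is rewritten; \<open>X\<close>
    collects the variables of the fixed left copy.\<close>
  using replace_equals[of "vars_tm (s \<^bold>\<circ> t)" "\<lambda>a b. s \<^bold>\<circ> t \<^bold>= a \<^bold>\<circ> b" \<Gamma> s s' t t']
  by (simp add: EqRefl)

section \<open>The axioms at closed terms\<close>

lemma vars_bit [simp]: "vars_tm (bit b) = {}"
  by (simp add: bit_def)

lemma biteral_snoc [simp]: "biteral (\<alpha> @ [b]) = biteral \<alpha> \<^bold>\<circ> bit b"
  by (simp add: biteral_def)

lemma vars_biteral [simp]: "vars_tm (biteral \<alpha>) = {}"
  by (induction \<alpha> rule: rev_induct) (simp_all add: biteral_Nil)

lemma fv_disjunction: "fv (disjunction \<phi>s) = (\<Union>\<phi>\<in>set \<phi>s. fv \<phi>)"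
  by (induction \<phi>s rule: disjunction.induct) auto

lemma subst_disjunction: "subst x t (disjunction \<phi>s) = disjunction (map (subst x t) \<phi>s)"
  by (induction \<phi>s rule: disjunction.induct) auto

lemma free_for_disjunction: "free_for x t (disjunction \<phi>s)" if "\<forall>\<phi>\<in>set \<phi>s. free_for x t \<phi>"
  using that by (induction \<phi>s rule: disjunction.induct) auto

text \<open>Closed axioms satisfy every eigenvariable condition, so only the equations added to them
  matter for freshness.\<close>

lemma fv_F' [simp]: "\<phi> \<in> F' \<Longrightarrow> fv \<phi> = {}"
  by (induction rule: F'.induct) (auto simp: fv_disjunction)

context
  fixes \<Gamma> :: "fm set"
  assumes F': "F' \<subseteq> \<Gamma>"
begin

lemma axiom: "\<phi> \<in> F' \<Longrightarrow> \<Gamma> \<turnstile> \<phi>"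
  using F' by (auto intro: Assm)

lemma eps_conc: "vars_tm t = {} \<Longrightarrow> \<Gamma> \<turnstile> t \<^bold>= \<^bold>e \<^bold>\<circ> t"
  using ConE1 ForallE[OF axiom[OF F1], of t] by simp

lemma conc_eps: "vars_tm t = {} \<Longrightarrow> \<Gamma> \<turnstile> t \<^bold>= t \<^bold>\<circ> \<^bold>e"
  using ConE2 ForallE[OF axiom[OF F1], of t] by simp

text \<open>Quantifiers are peeled off one at a time. Closed terms cannot be captured and are left
  unchanged by the later substitutions.\<close>

lemma conc_assoc:
  assumes "vars_tm r = {}" "vars_tm s = {}" "vars_tm t = {}"
  shows "\<Gamma> \<turnstile> (r \<^bold>\<circ> s) \<^bold>\<circ> t \<^bold>= r \<^bold>\<circ> (s \<^bold>\<circ> t)"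
proof -
  have "\<Gamma> \<turnstile> \<^bold>\<forall>1. \<^bold>\<forall>2. (r \<^bold>\<circ> Var 1) \<^bold>\<circ> Var 2 \<^bold>= r \<^bold>\<circ> (Var 1 \<^bold>\<circ> Var 2)"
    using ForallE[OF axiom[OF F2], of r] assms by simp
  from ForallE[OF this, of s] have "\<Gamma> \<turnstile> \<^bold>\<forall>2. (r \<^bold>\<circ> s) \<^bold>\<circ> Var 2 \<^bold>= r \<^bold>\<circ> (s \<^bold>\<circ> Var 2)"
    using assms by simp
  from ForallE[OF this, of t] show ?thesis
    using assms by simp
qed

lemma conc_bit_neq:
  assumes "vars_tm s = {}" "vars_tm t = {}" "\<Gamma> \<turnstile> \<^bold>\<not> s \<^bold>= t"
  shows "\<Gamma> \<turnstile> \<^bold>\<not> s \<^bold>\<circ> bit b \<^bold>= t \<^bold>\<circ> bit b"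
proof -
  have "\<Gamma> \<turnstile> \<^bold>\<forall>1. \<^bold>\<not> s \<^bold>= Var 1 \<^bold>\<longrightarrow>
      \<^bold>\<not> s \<^bold>\<circ> \<^bold>0 \<^bold>= Var 1 \<^bold>\<circ> \<^bold>0 \<^bold>\<and> \<^bold>\<not> s \<^bold>\<circ> \<^bold>1 \<^bold>= Var 1 \<^bold>\<circ> \<^bold>1"
    using ForallE[OF axiom[OF F3], of s] assms by simp
  from ForallE[OF this, of t]
  have "\<Gamma> \<turnstile> \<^bold>\<not> s \<^bold>= t \<^bold>\<longrightarrow> \<^bold>\<not> s \<^bold>\<circ> \<^bold>0 \<^bold>= t \<^bold>\<circ> \<^bold>0 \<^bold>\<and> \<^bold>\<not> s \<^bold>\<circ> \<^bold>1 \<^bold>= t \<^bold>\<circ> \<^bold>1"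
    using assms by simp
  note conj = ImpE[OF this assms(3)]
  from ConE1[OF conj] ConE2[OF conj] show ?thesis
    by (simp add: bit_def)
qed

lemma conc_distinct_bits_neq:
  assumes "vars_tm s = {}" "vars_tm t = {}" "a \<noteq> b"
  shows "\<Gamma> \<turnstile> \<^bold>\<not> s \<^bold>\<circ> bit a \<^bold>= t \<^bold>\<circ> bit b"
proof -
  have "\<Gamma> \<turnstile> \<^bold>\<not> s \<^bold>\<circ> \<^bold>0 \<^bold>= t \<^bold>\<circ> \<^bold>1" if "vars_tm s = {}" "vars_tm t = {}" for s t
  proof -
    have "\<Gamma> \<turnstile> \<^bold>\<forall>1. \<^bold>\<not> s \<^bold>\<circ> \<^bold>0 \<^bold>= Var 1 \<^bold>\<circ> \<^bold>1"
      using ForallE[OF axiom[OF F4], of s] that by simp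
    from ForallE[OF this, of t] show ?thesis using that by simp
  qed
  \<comment> \<open>The axiom fixes the order of the two bits; the opposite order follows by
    symmetry.\<close>
  then show ?thesis
    using assms by (cases a) (auto simp: bit_def intro: neq_sym[of _ "t \<^bold>\<circ> \<^bold>0"])
qed

lemma eps_le: "vars_tm t = {} \<Longrightarrow> \<Gamma> \<turnstile> \<^bold>e \<^bold>\<sqsubseteq> t"
  using ForallE[OF axiom[OF F5], of t] by simp

lemma le_eps_imp_eq: "vars_tm t = {} \<Longrightarrow> \<Gamma> \<turnstile> t \<^bold>\<sqsubseteq> \<^bold>e \<^bold>\<longrightarrow> t \<^bold>= \<^bold>e"
  using ForallE[OF axiom[OF F6], of t] by simp

lemma conc_bit_le_iff:
  assumes "vars_tm s = {}" "vars_tm t = {}"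
  shows "\<Gamma> \<turnstile> s \<^bold>\<circ> bit a \<^bold>\<sqsubseteq> t \<^bold>\<circ> bit b \<^bold>\<longleftrightarrow> s \<^bold>\<sqsubseteq> t"
proof -
  have "bit a \<in> {\<^bold>0, \<^bold>1}" "bit b \<in> {\<^bold>0, \<^bold>1}"
    by (simp_all add: bit_def)
  from ForallE[OF axiom[OF F7_10[OF this]], of s]
  have "\<Gamma> \<turnstile> \<^bold>\<forall>1. s \<^bold>\<circ> bit a \<^bold>\<sqsubseteq> Var 1 \<^bold>\<circ> bit b \<^bold>\<longleftrightarrow> s \<^bold>\<sqsubseteq> Var 1"
    using assms by simp
  from ForallE[OF this, of t] show ?thesis
    using assms by simp
qed

text \<open>Instantiated at a variable, since the variable of a bounded universal quantifier is what
  gets split into cases. The body is quantifier-free, so nothing is captured.\<close>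

lemma le_biteral_imp:
  "\<Gamma> \<turnstile> Var x \<^bold>\<sqsubseteq> biteral \<alpha> \<^bold>\<longrightarrow> disjunction (map (\<lambda>\<beta>. Var x \<^bold>= biteral \<beta>) (up_to \<alpha>))"
  using ForallE[OF axiom[OF F_bound], of "Var x" \<alpha>]
  by (simp add: subst_disjunction free_for_disjunction comp_def)

section \<open>Atomic sentences about biterals\<close>

text \<open>Biterals grow on the right, so induction on the last bit of \<beta> costs one use of
  associativity per step.\<close>

lemma biteral_append: "\<Gamma> \<turnstile> biteral \<alpha> \<^bold>\<circ> biteral \<beta> \<^bold>= biteral (\<alpha> @ \<beta>)"
proof (induction \<beta> rule: rev_induct)
  case Nil
  then show ?case by (simp add: biteral_Nil conc_eps eq_sym)
next
  case (snoc b \<beta>)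
  have "\<Gamma> \<turnstile> biteral \<alpha> \<^bold>\<circ> (biteral \<beta> \<^bold>\<circ> bit b) \<^bold>= (biteral \<alpha> \<^bold>\<circ> biteral \<beta>) \<^bold>\<circ> bit b"
    by (simp add: conc_assoc eq_sym)
  moreover have "\<Gamma> \<turnstile> (biteral \<alpha> \<^bold>\<circ> biteral \<beta>) \<^bold>\<circ> bit b \<^bold>= biteral (\<alpha> @ \<beta>) \<^bold>\<circ> bit b"
    by (simp add: conc_cong snoc.IH EqRefl)
  ultimately have "\<Gamma> \<turnstile> biteral \<alpha> \<^bold>\<circ> (biteral \<beta> \<^bold>\<circ> bit b) \<^bold>= biteral (\<alpha> @ \<beta>) \<^bold>\<circ> bit b"
    by (rule eq_trans)
  then show ?case
    by (simp flip: append_assoc)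
qed

end

text \<open>Base case for refuting equations and inequalities of biterals. It stands outside the
  context because the axioms are applied over \<open>?\<Delta>\<close>, which also contains the
  equation to be refuted.\<close>

lemma conc_bit_neq_eps:
  assumes "F' \<subseteq> \<Gamma>" and t: "vars_tm t = {}"
  shows "\<Gamma> \<turnstile> \<^bold>\<not> t \<^bold>\<circ> bit a \<^bold>= \<^bold>e"
proof (rule NegI)
  let ?\<Delta> = "insert (t \<^bold>\<circ> bit a \<^bold>= \<^bold>e) \<Gamma>" and ?b = "bit (\<not> a)"
  have F': "F' \<subseteq> ?\<Delta>" using assms(1) by auto
  have "?\<Delta> \<turnstile> (?b \<^bold>\<circ> t) \<^bold>\<circ> bit a \<^bold>= ?b \<^bold>\<circ> (t \<^bold>\<circ> bit a)"
    using conc_assoc[OF F'] t by simp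
  moreover have "?\<Delta> \<turnstile> ?b \<^bold>\<circ> (t \<^bold>\<circ> bit a) \<^bold>= ?b \<^bold>\<circ> \<^bold>e"
    by (intro conc_cong EqRefl Assm) simp
  moreover have "?\<Delta> \<turnstile> ?b \<^bold>\<circ> \<^bold>e \<^bold>= ?b"
    by (rule eq_sym[OF conc_eps[OF F']]) simp
  moreover have "?\<Delta> \<turnstile> ?b \<^bold>= \<^bold>e \<^bold>\<circ> ?b"
    by (intro eps_conc[OF F']) simp
  ultimately show "?\<Delta> \<turnstile> (?b \<^bold>\<circ> t) \<^bold>\<circ> bit a \<^bold>= \<^bold>e \<^bold>\<circ> ?b"
    using eq_trans by metis
  show "?\<Delta> \<turnstile> \<^bold>\<not> (?b \<^bold>\<circ> t) \<^bold>\<circ> bit a \<^bold>= \<^bold>e \<^bold>\<circ> ?b"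
    by (rule conc_distinct_bits_neq[OF F']) (simp_all add: t)
qed

context
  fixes \<Gamma> :: "fm set"
  assumes F': "F' \<subseteq> \<Gamma>"
begin

text \<open>Last bits are compared: equal ones cancel, distinct ones already separate the
  strings.\<close>

lemma biteral_neq: "\<alpha> \<noteq> \<beta> \<Longrightarrow> \<Gamma> \<turnstile> \<^bold>\<not> biteral \<alpha> \<^bold>= biteral \<beta>"
proof (induction \<alpha> arbitrary: \<beta> rule: rev_induct)
  case Nil
  then show ?case
    by (cases \<beta> rule: rev_cases) (auto simp: biteral_Nil intro: neq_sym[OF conc_bit_neq_eps[OF F']])
next
  case (snoc a \<alpha>)
  show ?case
  proof (cases \<beta> rule: rev_cases)
    case Nil
    then show ?thesis by (simp add: biteral_Nil conc_bit_neq_eps[OF F'])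
  next
    case (snoc \<beta>' b)
    with snoc.prems snoc.IH[of \<beta>'] show ?thesis
      by (cases "a = b") (auto intro: conc_bit_neq[OF F'] conc_distinct_bits_neq[OF F'])
  qed
qed

text \<open>Last bits can be stripped whatever their values, so only the lengths count.\<close>

lemma biteral_le: "length \<alpha> \<le> length \<beta> \<Longrightarrow> \<Gamma> \<turnstile> biteral \<alpha> \<^bold>\<sqsubseteq> biteral \<beta>"
proof (induction \<alpha> arbitrary: \<beta> rule: rev_induct)
  case Nil
  then show ?case by (simp add: biteral_Nil eps_le[OF F'])
next
  case (snoc a \<alpha>)
  then show ?case
    by (cases \<beta> rule: rev_cases) (auto intro: ImpE[OF ConE2[OF conc_bit_le_iff[OF F']]])
qed

text \<open>Stripping last bits ends with a nonempty string below \<open>e\<close>, which would have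
  to equal \<open>e\<close>.\<close>

lemma biteral_not_le: "length \<beta> < length \<alpha> \<Longrightarrow> \<Gamma> \<turnstile> \<^bold>\<not> biteral \<alpha> \<^bold>\<sqsubseteq> biteral \<beta>"
proof (induction \<alpha> arbitrary: \<beta> rule: rev_induct)
  case Nil
  then show ?case by simp
next
  case (snoc a \<alpha>)
  show ?case
  proof (cases \<beta> rule: rev_cases)
    case Nil
    then show ?thesis
      by (auto simp: biteral_Nil
          intro!: modus_tollens[OF le_eps_imp_eq[OF F']] conc_bit_neq_eps[OF F'])
  next
    case (snoc \<beta>' b)
    with snoc.prems snoc.IH[of \<beta>'] show ?thesis
      by (auto intro!: modus_tollens[OF ConE1[OF conc_bit_le_iff[OF F']]])
  qed
qed

section \<open>Completeness for Sigma-formulas\<close>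

lemma eq_biteral_eval:
  assumes "\<And>y. y \<in> vars_tm t \<Longrightarrow> \<Gamma> \<turnstile> Var y \<^bold>= biteral (v y)"
  shows "\<Gamma> \<turnstile> t \<^bold>= biteral (eval v t)"
  using assms
proof (induction t)
  case (Conc s t)
  have "\<Gamma> \<turnstile> s \<^bold>\<circ> t \<^bold>= biteral (eval v s) \<^bold>\<circ> biteral (eval v t)"
    using Conc by (intro conc_cong) auto
  then show ?case
    using eq_trans[OF _ biteral_append[OF F']] by simp
\<comment> \<open>A one-bit biteral is \<open>e\<close> followed by the bit, so the constants 0 and
  1 need the unit axiom.\<close>
qed (use eps_conc[OF F'] in \<open>auto simp: biteral_def bit_def intro: EqRefl\<close>)

text \<open>Abstracting over \<open>R\<close> treats the atoms and their negations alike: each is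
  transported from the biterals of the values back to the terms.\<close>

lemma provable_atom:
  assumes "\<And>x u a b. subst x u (R a b) = R (subst_tm x u a) (subst_tm x u b)"
    and "\<And>x u a b. free_for x u (R a b)"
    and "\<And>y. y \<in> vars_tm s \<union> vars_tm t \<Longrightarrow> \<Gamma> \<turnstile> Var y \<^bold>= biteral (v y)"
    and "\<Gamma> \<turnstile> R (biteral (eval v s)) (biteral (eval v t))"
  shows "\<Gamma> \<turnstile> R s t"
  using assms by (intro replace_equals[of "{}" R _ "biteral (eval v s)" s "biteral (eval v t)" t]
      eq_sym[OF eq_biteral_eval]) auto

end

text \<open>The set \<open>Y\<close> is explicit so that equations can be limited to the free
  variables, which leaves a quantified variable fresh.\<close>

definition hyps :: "(nat \<Rightarrow> bitstring) \<Rightarrow> nat set \<Rightarrow> fm set" where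
  "hyps v Y = F' \<union> (\<lambda>y. Var y \<^bold>= biteral (v y)) ` Y"

lemma F'_subset_hyps: "F' \<subseteq> hyps v Y"
  by (simp add: hyps_def)

lemma hyps_mono: "Y \<subseteq> Z \<Longrightarrow> hyps v Y \<subseteq> hyps v Z"
  by (auto simp: hyps_def)

lemma hyps_Var: "y \<in> Y \<Longrightarrow> hyps v Y \<turnstile> Var y \<^bold>= biteral (v y)"
  by (auto simp: hyps_def intro: Assm)

lemma hyps_fresh: "x \<notin> Y \<Longrightarrow> \<forall>\<psi>\<in>hyps v Y. x \<notin> fv \<psi>"
  by (auto simp: hyps_def)

lemma hyps_update: "hyps (v(x := \<alpha>)) Y \<subseteq> insert (Var x \<^bold>= biteral \<alpha>) (hyps v (Y - {x}))"
  by (auto simp: hyps_def)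

lemma provable_Exists:
  assumes "hyps (v(x := \<alpha>)) (fv \<phi>) \<turnstile> \<phi>"
  shows "hyps v (fv (\<^bold>\<exists>x. \<phi>)) \<turnstile> \<^bold>\<exists>x. \<phi>"
proof (rule exists_elim_eq)
  have "insert (Var x \<^bold>= biteral \<alpha>) (hyps v (fv \<phi> - {x})) \<turnstile> \<phi>"
    using assms hyps_update by (rule Weaken)
  then show "insert (Var x \<^bold>= biteral \<alpha>) (hyps v (fv (\<^bold>\<exists>x. \<phi>))) \<turnstile> \<^bold>\<exists>x. \<phi>"
    \<comment> \<open>Under the equation for \<open>x\<close>, the variable \<open>x\<close> is its
      own witness.\<close>
    using ExistsI[of _ x "Var x" \<phi>] by simp
qed (auto intro!: hyps_fresh)

text \<open>Once \<open>t\<close> is replaced by the biteral of its value, the axiom for that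
  biteral leaves finitely many values of \<open>x\<close>, each covered by the assumption on
  \<phi>.\<close>

lemma provable_BForall:
  assumes x: "x \<notin> vars_tm t"
    and \<phi>: "\<And>\<alpha>. length \<alpha> \<le> length (eval v t) \<Longrightarrow> hyps (v(x := \<alpha>)) (fv \<phi>) \<turnstile> \<phi>"
  shows "hyps v (fv (BForall x t \<phi>)) \<turnstile> BForall x t \<phi>"
proof (intro ForallI ImpI)
  let ?Y = "fv (BForall x t \<phi>)"
  let ?\<Gamma> = "insert (Var x \<^bold>\<sqsubseteq> t) (hyps v ?Y)"
  have F': "F' \<subseteq> ?\<Gamma>" using F'_subset_hyps by auto
  have "?\<Gamma> \<turnstile> t \<^bold>= biteral (eval v t)"
    using x by (intro eq_biteral_eval[OF F'] provable_insert hyps_Var) auto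
  then have "?\<Gamma> \<turnstile> Var x \<^bold>\<sqsubseteq> biteral (eval v t)"
    using replace_equals[of "{}" "(\<^bold>\<sqsubseteq>)" ?\<Gamma> "Var x" "Var x" t] by (simp add: EqRefl Assm)
  from ImpE[OF le_biteral_imp[OF F'] this] show "?\<Gamma> \<turnstile> \<phi>"
  proof (rule disjunction_elim)
    fix \<chi> assume "\<chi> \<in> set (map (\<lambda>\<beta>. Var x \<^bold>= biteral \<beta>) (up_to (eval v t)))"
    then obtain \<beta> where \<chi>: "\<chi> = (Var x \<^bold>= biteral \<beta>)" and "length \<beta> \<le> length (eval v t)"
      by (auto simp: set_up_to)
    then have "hyps (v(x := \<beta>)) (fv \<phi>) \<turnstile> \<phi>" by (intro \<phi>)
    \<comment> \<open>The equation of the current case supplies the updated value of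
      \<open>x\<close>; all other equations needed for \<phi> are already present.\<close>
    moreover have "hyps v (fv \<phi> - {x}) \<subseteq> hyps v ?Y"
      by (rule hyps_mono) auto
    ultimately show "insert \<chi> ?\<Gamma> \<turnstile> \<phi>"
      using hyps_update[of v x \<beta> "fv \<phi>"] \<chi> by (elim Weaken) blast
  qed
qed (auto intro!: hyps_fresh)

text \<open>The valuation varies in the induction because the quantifier cases use the hypothesis at
  updated valuations.\<close>

lemma Sigma_complete: "Sigma_formula \<phi> \<Longrightarrow> sat v \<phi> \<Longrightarrow> hyps v (fv \<phi>) \<turnstile> \<phi>"
proof (induction arbitrary: v rule: Sigma_formula.induct)
  case (1 s t)
  then show ?case
    by (intro provable_atom[OF F'_subset_hyps, where R = "(\<^bold>\<sqsubseteq>)" and s = s and t = t and v = v]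
        biteral_le[OF F'_subset_hyps] hyps_Var) auto
next
  case (2 s t)
  then show ?case
    by (intro provable_atom[OF F'_subset_hyps,
          where R = "\<lambda>a b. \<^bold>\<not> a \<^bold>\<sqsubseteq> b" and s = s and t = t and v = v]
        biteral_not_le[OF F'_subset_hyps] hyps_Var) auto
next
  case (3 s t)
  then show ?case
    by (intro provable_atom[OF F'_subset_hyps, where R = "(\<^bold>=)" and s = s and t = t and v = v]
        hyps_Var) (auto intro: EqRefl)
next
  case (4 s t)
  then show ?case
    by (intro provable_atom[OF F'_subset_hyps,
          where R = "\<lambda>a b. \<^bold>\<not> a \<^bold>= b" and s = s and t = t and v = v]
        biteral_neq[OF F'_subset_hyps] hyps_Var) auto
next
  case (5 \<phi> \<psi>)
  then have "hyps v (fv \<phi>) \<turnstile> \<phi>" "hyps v (fv \<psi>) \<turnstile> \<psi>" by auto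
  then show ?case by (intro ConI; elim Weaken) (auto intro!: hyps_mono)
next
  case (6 \<phi> \<psi>)
  then consider "hyps v (fv \<phi>) \<turnstile> \<phi>" | "hyps v (fv \<psi>) \<turnstile> \<psi>" by auto
  then show ?case
  proof cases
    case 1
    then show ?thesis by (intro DisI1; elim Weaken) (auto intro!: hyps_mono)
  next
    case 2
    then show ?thesis by (intro DisI2; elim Weaken) (auto intro!: hyps_mono)
  qed
next
  case (7 \<phi> x t)
  then obtain \<alpha> where le: "length \<alpha> \<le> length (eval (v(x := \<alpha>)) t)" and "sat (v(x := \<alpha>)) \<phi>"
    by auto
  let ?\<psi> = "Var x \<^bold>\<sqsubseteq> t \<^bold>\<and> \<phi>"
  let ?\<Gamma> = "hyps (v(x := \<alpha>)) (fv ?\<psi>)"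
  have "hyps (v(x := \<alpha>)) (fv \<phi>) \<turnstile> \<phi>"
    by (rule "7.IH") fact
  then have "?\<Gamma> \<turnstile> \<phi>"
    by (rule Weaken) (auto intro!: hyps_mono)
  \<comment> \<open>The bound is itself an atom true under the updated valuation, so this case
    becomes an unbounded existential over a conjunction.\<close>
  moreover have "?\<Gamma> \<turnstile> Var x \<^bold>\<sqsubseteq> t"
    using le by (intro provable_atom[OF F'_subset_hyps,
          where R = "(\<^bold>\<sqsubseteq>)" and s = "Var x" and t = t and v = "v(x := \<alpha>)"]
        biteral_le[OF F'_subset_hyps] hyps_Var) auto
  ultimately show ?case
    by (intro provable_Exists ConI)
next
  case (8 \<phi> x t)
  \<comment> \<open>The range of \<open>x\<close> must be measured under \<open>v\<close>, while
    truth of the formula measures it under the update.\<close>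
  have "eval (v(x := \<alpha>)) t = eval v t" for \<alpha>
    using \<open>x \<notin> vars_tm t\<close> by (induction t) auto
  with 8 show ?case
    by (intro provable_BForall) auto
next
  case (9 \<phi> x)
  then show ?case
    \<comment> \<open>Unfolding \<open>fv\<close> would destroy the form in which
      \<open>provable_Exists\<close> applies.\<close>
    by (auto simp del: fv.simps intro: provable_Exists)
qed

theorem theorem7:
  fixes \<phi> :: fm
  assumes "Sigma_formula \<phi>" and "sentence \<phi>"
    and "\<FF> \<Turnstile> \<phi>"
  shows "F' \<turnstile> \<phi>"
  using Sigma_complete[OF assms(1)] assms(2,3)
  \<comment> \<open>A sentence has no free variables, so \<open>hyps v {}\<close> is just
    \<open>F'\<close>, for any \<open>v\<close>.\<close>
  by (fastforce simp: sentence_def true_in_F_def hyps_def)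

end
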